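(* Let $\lambda\in\mathbb{R}$ and $x\in\mathbb{R}$. For every integer $n\ge 0$, $$D_{n,\lambda}(x)=\sum_{m=0}^{n}\beta_{m,\lambda}(x)\,S_{1}(n,m).$$
   Context: All generating functions are formal power series in $t$. For $\lambda,y\in\mathbb{R}$, set $(y)_{0,\lambda}=1$ and $(y)_{n,\lambda}=y(y-\lambda)\cdots(y-(n-1)\lambda)$ for $n\ge1$; the formal power series $(1+\lambda u)^{y/\lambda}$ means $\sum_{n\ge0}(y)_{n,\lambda}\frac{u^n}{n!}$ (the usual binomial series for $\lambda\ne0$, and the limit $e^{yu}$ for $\lambda=0$). The degenerate Bernoulli polynomials $\beta_{n,\lambda}(x)$ (Carlitz) are defined by $\frac{t}{(1+\lambda t)^{1/\lambda}-1}(1+\lambda t)^{x/\lambda}=\sum_{n=0}^\infty \beta_{n,\lambda}(x)\frac{t^n}{n!}$. The degenerate Daehee polynomials of the second kind $D_{n,\lambda}(x)$ are defined by $\frac{\log(1+t)}{(1+\lambda\log(1+t))^{1/\lambda}-1}(1+\lambda\log(1+t))^{x/\lambda}=\sum_{n=0}^\infty D_{n,\lambda}(x)\frac{t^n}{n!}$. $S_1(n,l)$ are the (signed) Stirling numbers of the first kind: $x(x-1)\cdots(x-n+1)=\sum_{l=0}^n S_1(n,l)x^l$ (the empty product being $1$ for $n=0$). *)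

theory Defs
  imports "HOL-Computational_Algebra.Computational_Algebra"
begin

definition degenerate_ffact :: "real \<Rightarrow> real \<Rightarrow> nat \<Rightarrow> real" where
  "degenerate_ffact lam y n = (\<Prod>i<n. y - real i * lam)"

text \<open>
  The formal power series \<open>(1 + lam u)^(y/lam)\<close> in \<open>u\<close>, which is \<open>e^(y u)\<close> for \<open>lam = 0\<close>;
  see \<open>degenerate_exp_nonzero\<close> and \<open>degenerate_exp_0\<close> below.
\<close>
definition degenerate_exp :: "real \<Rightarrow> real \<Rightarrow> real fps" where
  "degenerate_exp lam y = Abs_fps (\<lambda>n. degenerate_ffact lam y n / fact n)"

text \<open>
  The denominators in the next two definitions have subdegree 1
  (\<open>subdegree_degenerate_exp_minus_1\<close>, \<open>subdegree_degenerate_exp_log_minus_1\<close>), as do the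
  numerators, so the divisions are exact. The series \<open>fps_ln 1\<close> is \<open>log (1 + t)\<close>.
\<close>
definition degenerate_bernoulli :: "real \<Rightarrow> nat \<Rightarrow> real \<Rightarrow> real" where
  "degenerate_bernoulli lam n x =
     fact n * fps_nth (fps_X / (degenerate_exp lam 1 - 1) * degenerate_exp lam x) n"

definition degenerate_daehee2 :: "real \<Rightarrow> nat \<Rightarrow> real \<Rightarrow> real" where
  "degenerate_daehee2 lam n x =
     fact n * fps_nth (fps_ln 1 / ((degenerate_exp lam 1 oo fps_ln 1) - 1)
                        * (degenerate_exp lam x oo fps_ln 1)) n"

definition signed_stirling1 :: "nat \<Rightarrow> nat \<Rightarrow> real" where
  "signed_stirling1 n l = coeff (\<Prod>i<n. [:- real i, 1:]) l"

lemma degenerate_exp_0: "degenerate_exp 0 y = fps_exp y"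
  by (simp add: degenerate_exp_def degenerate_ffact_def fps_eq_iff)

lemma degenerate_exp_nonzero:
  assumes "lam \<noteq> 0"
  shows "degenerate_exp lam y = fps_binomial (y / lam) oo (fps_const lam * fps_X)"
proof (rule fps_ext)
  fix n
  have "degenerate_ffact lam y n = (\<Prod>i<n. lam * (y / lam - real i))"
    unfolding degenerate_ffact_def using assms by (intro prod.cong) (auto simp: field_simps)
  also have "\<dots> = lam ^ n * (\<Prod>i<n. y / lam - real i)"
    by (simp add: prod.distrib)
  finally show "fps_nth (degenerate_exp lam y) n =
      fps_nth (fps_binomial (y / lam) oo (fps_const lam * fps_X)) n"
    by (simp add: degenerate_exp_def fps_compose_linear gbinomial_prod_rev atLeast0LessThan)
qed

lemma subdegree_degenerate_exp_minus_1: "subdegree (degenerate_exp lam 1 - 1) = 1"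
  by (rule subdegreeI) (auto simp: degenerate_exp_def degenerate_ffact_def)

lemma subdegree_degenerate_exp_log_minus_1:
  "subdegree ((degenerate_exp lam 1 oo fps_ln 1) - 1) = 1"
  by (rule subdegreeI)
     (auto simp: degenerate_exp_def degenerate_ffact_def fps_compose_nth fps_ln_nth)

lemma degenerate_bernoulli_gf:
  "fps_X / (degenerate_exp lam 1 - 1) * degenerate_exp lam x =
     Abs_fps (\<lambda>n. degenerate_bernoulli lam n x / fact n)"
  by (simp add: fps_eq_iff degenerate_bernoulli_def)

lemma degenerate_daehee2_gf:
  "fps_ln 1 / ((degenerate_exp lam 1 oo fps_ln 1) - 1) * (degenerate_exp lam x oo fps_ln 1) =
     Abs_fps (\<lambda>n. degenerate_daehee2 lam n x / fact n)"
  by (simp add: fps_eq_iff degenerate_daehee2_def)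

lemma degree_ffact_poly: "degree (\<Prod>i<n. [:- real i, 1:]) = n"
  by (subst degree_prod_eq_sum_degree) auto

lemma signed_stirling1_ffact:
  "(\<Prod>i<n. x - real i) = (\<Sum>l=0..n. signed_stirling1 n l * x ^ l)"
proof -
  have "(\<Prod>i<n. x - real i) = poly (\<Prod>i<n. [:- real i, 1:]) x"
    by (simp add: poly_prod)
  also have "\<dots> = (\<Sum>l=0..n. signed_stirling1 n l * x ^ l)"
    by (simp only: poly_altdef degree_ffact_poly signed_stirling1_def atMost_atLeast0)
  finally show ?thesis .
qed

end

theory Submission
  imports Defs
begin

text \<open>
  The generating function of the Daehee polynomials is that of the Bernoulli polynomials
  composed with \<open>log (1 + t)\<close>, and the coefficient of \<open>t^n / n!\<close> in \<open>log (1 + t)^m / m!\<close> is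
  \<open>S\<^sub>1(n, m)\<close>: by the differential equation \<open>(1 + t) (L^m)' = m L^(m - 1)\<close> for \<open>L = log (1 + t)\<close>,
  both satisfy \<open>S\<^sub>1(n + 1, m) = S\<^sub>1(n, m - 1) - n S\<^sub>1(n, m)\<close>.
\<close>

lemma signed_stirling1_0: "signed_stirling1 0 m = (if m = 0 then 1 else 0)"
  by (simp add: signed_stirling1_def)

lemma signed_stirling1_Suc_0: "signed_stirling1 (Suc n) 0 = - real n * signed_stirling1 n 0"
  by (simp add: signed_stirling1_def mult.commute)

text \<open>Split off the last factor \<open>[:- real n, 1:]\<close>: its linear term shifts
  coefficients by one, its constant term scales them by -n.\<close>

lemma signed_stirling1_Suc_Suc:
  "signed_stirling1 (Suc n) (Suc m) = signed_stirling1 n m - real n * signed_stirling1 n (Suc m)"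
proof -
  have "(\<Prod>i<Suc n. [:- real i, 1:]) = [:- real n, 1:] * (\<Prod>i<n. [:- real i, 1:])"
    by (simp add: mult.commute)
  then show ?thesis
    unfolding signed_stirling1_def by simp
qed

lemma fps_ln_1_power_deriv:
  "(1 + fps_X) * fps_deriv (fps_ln (1 :: 'a :: field_char_0) ^ Suc m) =
     of_nat (Suc m) * fps_ln 1 ^ m"
proof -
  have "(1 + fps_X) * inverse (1 + fps_X) = (1 :: 'a fps)"
    by (rule inverse_mult_eq_1') simp
  then have "(1 + fps_X) * fps_deriv (fps_ln (1 :: 'a)) = 1"
    by (simp add: fps_ln_deriv)
  moreover have "fps_deriv (fps_ln (1 :: 'a) ^ Suc m) =
      of_nat (Suc m) * (fps_deriv (fps_ln 1) * fps_ln 1 ^ m)"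
    by (simp add: fps_deriv_power fps_of_nat mult.assoc del: power_Suc of_nat_Suc)
  ultimately show ?thesis
    by (metis mult.assoc mult.left_commute mult_1)
qed

text \<open>Compare coefficients of t^n in the differential equation; the factor 1 + t brings in the
  derivative at n and at n - 1.\<close>

lemma fps_ln_1_power_nth_Suc:
  "of_nat (Suc n) * fps_nth (fps_ln (1 :: 'a :: field_char_0) ^ Suc m) (Suc n) =
     of_nat (Suc m) * fps_nth (fps_ln 1 ^ m) n - of_nat n * fps_nth (fps_ln 1 ^ Suc m) n"
proof -
  have "fps_nth ((1 + fps_X) * fps_deriv (fps_ln (1 :: 'a) ^ Suc m)) n =
      of_nat (Suc n) * fps_nth (fps_ln 1 ^ Suc m) (Suc n) +
      of_nat n * fps_nth (fps_ln 1 ^ Suc m) n"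
    by (cases n) (simp_all add: distrib_right del: power_Suc of_nat_Suc)
  then show ?thesis
    unfolding fps_ln_1_power_deriv
    by (simp add: fps_of_nat[symmetric] del: power_Suc of_nat_Suc)
qed

lemma fps_ln_1_power_nth:
  "fact n * fps_nth (fps_ln 1 ^ m) n = fact m * signed_stirling1 n m"
proof (induction n arbitrary: m)
  case 0
  then show ?case
    by (cases m) (simp_all add: signed_stirling1_0)
next
  case (Suc n)
  show ?case
  proof (cases m)
    \<comment> \<open>Both sides vanish: L^0 = 1 has no term of positive degree, and the factor -n
      is 0 for n = 0, while for n > 0 the induction hypothesis gives S_1(n, 0) = 0.\<close>
    case 0
    then show ?thesis
      using Suc.IH[of 0] by (cases n) (simp_all add: signed_stirling1_Suc_0)
  next
    case (Suc k)
    have "fact (Suc n) * fps_nth (fps_ln 1 ^ Suc k) (Suc n) =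
        fact n * (real (Suc n) * fps_nth (fps_ln 1 ^ Suc k) (Suc n))"
      by (simp del: power_Suc)
    also have "\<dots> = real (Suc k) * (fact n * fps_nth (fps_ln 1 ^ k) n) -
        real n * (fact n * fps_nth (fps_ln 1 ^ Suc k) n)"
      unfolding fps_ln_1_power_nth_Suc by (simp only: right_diff_distrib mult.left_commute)
    also have "\<dots> = fact (Suc k) * signed_stirling1 (Suc n) (Suc k)"
      unfolding Suc.IH signed_stirling1_Suc_Suc by (simp add: algebra_simps)
    finally show ?thesis
      using Suc by simp
  qed
qed

theorem theorem2p1:
  fixes lam x :: real and n :: nat
  shows "degenerate_daehee2 lam n x =
    (\<Sum>m=0..n. degenerate_bernoulli lam m x * signed_stirling1 n m)"
proof -
  let ?L = "fps_ln (1 :: real)" and ?d = "degenerate_exp lam 1 - 1"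
  \<comment> \<open>Composition commutes with this quotient because the division is exact and the
    composed denominator is nonzero; both follow from the subdegrees being 1.\<close>
  have "?d dvd fps_X"
    using subdegree_degenerate_exp_minus_1[of lam]
    by (subst fps_dvd_iff) auto
  moreover have "?d oo ?L \<noteq> 0"
    using subdegree_degenerate_exp_log_minus_1[of lam]
    by (auto simp: fps_compose_sub_distrib)
  ultimately have "(fps_X / ?d * degenerate_exp lam x) oo ?L =
      ?L / ((degenerate_exp lam 1 oo ?L) - 1) * (degenerate_exp lam x oo ?L)"
    by (simp add: fps_compose_mult_distrib fps_compose_divide_distrib fps_compose_sub_distrib)
  then have "degenerate_daehee2 lam n x =
      fact n * fps_nth (Abs_fps (\<lambda>m. degenerate_bernoulli lam m x / fact m) oo ?L) n"
    by (simp add: degenerate_daehee2_def degenerate_bernoulli_gf)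
  also have "\<dots> = (\<Sum>m=0..n. degenerate_bernoulli lam m x / fact m * (fact n * fps_nth (?L ^ m) n))"
    by (simp add: fps_compose_nth sum_distrib_left mult.left_commute)
  also have "\<dots> = (\<Sum>m=0..n. degenerate_bernoulli lam m x * signed_stirling1 n m)"
    by (simp add: fps_ln_1_power_nth)
  finally show ?thesis .
qed

end
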